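(* Let $\alpha=p/q$, where $p,q$ are fixed positive integers with $p<q/2$, and let $0<c\le 1$ be a constant. For $i=1,\ldots,k$, let player $i$ hold a set $A_i\subset[n]=\{1,2,\ldots,n\}$ that is disjoint from any other player's set. Assume that $t=\left|\bigcup_{i=1}^k A_i\right|\ge cn$. Put $\ell=\left\lceil \log\frac{2q}{c}\right\rceil$. Then an $(\alpha t,\alpha t)$-mediocre element of $\bigcup_{i=1}^k A_i$ can be found by a deterministic protocol with communication complexity $O(\ell\cdot k\log n)=O(k\log n)$.
   Context: Multiparty communication model: each of the $k$ players knows only his/her own input $A_i$ (and the public parameters $n,k,\alpha,c$). Players communicate by broadcasting bits: every message sent by one player is seen by all players (blackboard). A deterministic protocol specifies, as a function of the messages sent so far, who speaks next, and each message is a function of the speaker's own input and the messages so far. At the end of the protocol the required output is known to the players. The communication complexity of a protocol is the maximum, over all admissible inputs, of the total number of bits broadcast; local computation is free. Mediocre element: an element of a finite totally ordered set $S$ is $(i,j)$-mediocre if it is neither among the top (i.e., largest) $i$ nor among the bottom (i.e., smallest) $j$ elements of $S$. Floors are omitted in the notation: $(\alpha t,\alpha t)$-mediocre means $(\lfloor\alpha t\rfloor,\lfloor\alpha t\rfloor)$-mediocre. The sets $A_i$ need not have the same cardinality. Here $n\ge 2$, logarithms are in base $2$, and the asymptotic notation is with $p,q,c$ fixed: the implied constants do not depend on $n$, $k$, or the inputs (in the last bound $O(k\log n)$ the constant may depend on $q$ and $c$). *)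

theory Defs
  imports Complex_Main "HOL-Library.Disjoint_Sets"
begin

(* Blackboard protocols as decision trees. A node of the tree stands for the bits broadcast so far;
   it names the player who speaks next and the bit sent as a function of that player's own input.
   The first subtree is entered on bit False, the second on bit True. The output is a function
   of the blackboard alone, hence known to all players. *)
datatype ('a, 'b) protocol =
    Output 'b
  | Speak nat "'a \<Rightarrow> bool" "('a, 'b) protocol" "('a, 'b) protocol"

primrec speakers :: "('a, 'b) protocol \<Rightarrow> nat set" where
  "speakers (Output y) = {}"
| "speakers (Speak i m P Q) = insert i (speakers P \<union> speakers Q)"

primrec transcript :: "('a, 'b) protocol \<Rightarrow> (nat \<Rightarrow> 'a) \<Rightarrow> bool list" where
  "transcript (Output y) A = []"
| "transcript (Speak i m P Q) A =
     m (A i) # (if m (A i) then transcript Q A else transcript P A)"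

primrec result :: "('a, 'b) protocol \<Rightarrow> (nat \<Rightarrow> 'a) \<Rightarrow> 'b" where
  "result (Output y) A = y"
| "result (Speak i m P Q) A = (if m (A i) then result Q A else result P A)"

(* The supremum is a maximum: the values are bounded by the lemma below, and on nat the
   supremum of the empty set is 0. *)
definition comm_complexity :: "('a, 'b) protocol \<Rightarrow> (nat \<Rightarrow> 'a) set \<Rightarrow> nat" where
  "comm_complexity P \<A> = (SUP A\<in>\<A>. length (transcript P A))"

lemma finite_transcript_lengths: "finite ((\<lambda>A. length (transcript P A)) ` \<A>)"
proof -
  have "\<exists>b. \<forall>A. length (transcript P A) \<le> b"
  proof (induction P)
    case (Speak i m P Q)
    then obtain b1 b2 where "\<forall>A. length (transcript P A) \<le> b1" "\<forall>A. length (transcript Q A) \<le> b2"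
      by blast
    then have "\<forall>A. length (transcript (Speak i m P Q) A) \<le> Suc (max b1 b2)"
      by (auto simp: le_max_iff_disj)
    then show ?case by blast
  qed simp
  then show ?thesis
    by (auto simp: finite_nat_set_iff_bounded_le)
qed

definition top_elements :: "nat \<Rightarrow> 'a::linorder set \<Rightarrow> 'a set" where
  "top_elements i S = {x \<in> S. card {y \<in> S. x < y} < i}"

definition bottom_elements :: "nat \<Rightarrow> 'a::linorder set \<Rightarrow> 'a set" where
  "bottom_elements j S = {x \<in> S. card {y \<in> S. y < x} < j}"

definition mediocre :: "nat \<Rightarrow> nat \<Rightarrow> 'a::linorder set \<Rightarrow> 'a \<Rightarrow> bool" where
  "mediocre i j S x \<longleftrightarrow> x \<in> S \<and> x \<notin> top_elements i S \<and> x \<notin> bottom_elements j S"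

definition admissible :: "nat \<Rightarrow> nat \<Rightarrow> real \<Rightarrow> (nat \<Rightarrow> nat set) set" where
  "admissible n k c = {A. (\<forall>i\<in>{1..k}. A i \<subseteq> {1..n}) \<and> disjoint_family_on A {1..k} \<and>
     real (card (\<Union>i\<in>{1..k}. A i)) \<ge> c * real n}"

definition finds_mediocre ::
  "nat \<Rightarrow> nat \<Rightarrow> real \<Rightarrow> real \<Rightarrow> (nat set, nat) protocol \<Rightarrow> bool" where
  "finds_mediocre n k c \<alpha> P \<longleftrightarrow> speakers P \<subseteq> {1..k} \<and>
     (\<forall>A\<in>admissible n k c.
        let S = (\<Union>i\<in>{1..k}. A i); t = card S
        in mediocre (nat \<lfloor>\<alpha> * real t\<rfloor>) (nat \<lfloor>\<alpha> * real t\<rfloor>) S (result P A))"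

end

theory Submission
  imports Defs
begin

text \<open>
  The players announce their cardinalities and then bisect \<open>{1..n}\<close>, always keeping the half that
  contains the element of rank \<open>r = \<lceil>t/2\<rceil>\<close> of the union. After \<open>\<ell>\<close> rounds the interval has
  length \<open>L\<close> with \<open>L - 1 < n / 2^\<ell> \<le> t / (2q)\<close>. Since \<open>p/q \<le> 1/2 - 1/(2q)\<close>, every element of the
  union in this interval is mediocre, and the largest one is found by one more round of announcements.
\<close>

section \<open>Broadcasting numbers bit by bit\<close>

text \<open>Protocol trees have no sequential composition, so the rest of the protocol is passed as
  a continuation. The least significant bit goes first, and each bit sent is absorbed into the
  continuation, so that \<open>K\<close> finally receives the whole number.\<close>

primrec announce :: "nat \<Rightarrow> nat \<Rightarrow> ('a \<Rightarrow> nat) \<Rightarrow> (nat \<Rightarrow> ('a, 'b) protocol) \<Rightarrow> ('a, 'b) protocol" where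
  "announce 0 i f K = K 0"
| "announce (Suc b) i f K = Speak i (\<lambda>x. odd (f x))
     (announce b i (\<lambda>x. f x div 2) (\<lambda>v. K (2 * v)))
     (announce b i (\<lambda>x. f x div 2) (\<lambda>v. K (2 * v + 1)))"

lemma speakers_announce: "speakers (announce b i f K) \<subseteq> insert i (\<Union>v. speakers (K v))"
proof (induction b arbitrary: f K)
  case (Suc b)
  show ?case
    using Suc[of "\<lambda>x. f x div 2" "\<lambda>v. K (2 * v)"] Suc[of "\<lambda>x. f x div 2" "\<lambda>v. K (2 * v + 1)"]
    by fastforce
qed auto

text \<open>The \<open>b\<close> bits convey \<open>f (A i)\<close> only modulo
  \<open>2 ^ b\<close>; the bound makes this the value itself.\<close>

lemma result_announce:
  assumes "f (A i) < 2 ^ b"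
  shows "result (announce b i f K) A = result (K (f (A i))) A"
  using assms
proof (induction b arbitrary: f K)
  case (Suc b)
  then have "f (A i) div 2 < 2 ^ b" by simp
  then show ?case
    using Suc.IH[of "\<lambda>x. f x div 2"] by simp
qed simp

lemma length_transcript_announce:
  assumes "f (A i) < 2 ^ b"
  shows "length (transcript (announce b i f K) A) = b + length (transcript (K (f (A i))) A)"
  using assms
proof (induction b arbitrary: f K)
  case (Suc b)
  then have "f (A i) div 2 < 2 ^ b" by simp
  then show ?case
    using Suc.IH[of "\<lambda>x. f x div 2"] by simp
qed simp

primrec poll ::
  "nat \<Rightarrow> ('a \<Rightarrow> nat) \<Rightarrow> nat list \<Rightarrow> (nat list \<Rightarrow> ('a, 'b) protocol) \<Rightarrow> ('a, 'b) protocol" where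
  "poll b f [] K = K []"
| "poll b f (i # is) K = announce b i f (\<lambda>v. poll b f is (\<lambda>vs. K (v # vs)))"

lemma speakers_poll:
  assumes "\<And>vs. speakers (K vs) \<subseteq> V" "set is \<subseteq> V"
  shows "speakers (poll b f is K) \<subseteq> V"
  using assms
proof (induction "is" arbitrary: K)
  case (Cons i "is")
  then have "speakers (poll b f is (\<lambda>vs. K (v # vs))) \<subseteq> V" for v by simp
  then show ?case
    using speakers_announce[of b i f "\<lambda>v. poll b f is (\<lambda>vs. K (v # vs))"] Cons.prems by fastforce
qed simp

lemma result_poll:
  assumes "\<And>i. i \<in> set is \<Longrightarrow> f (A i) < 2 ^ b"
  shows "result (poll b f is K) A = result (K (map (\<lambda>i. f (A i)) is)) A"
  using assms by (induction "is" arbitrary: K) (simp_all add: result_announce)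

lemma length_transcript_poll:
  assumes "\<And>i. i \<in> set is \<Longrightarrow> f (A i) < 2 ^ b"
  shows "length (transcript (poll b f is K) A)
    = length is * b + length (transcript (K (map (\<lambda>i. f (A i)) is)) A)"
  using assms by (induction "is" arbitrary: K) (simp_all add: length_transcript_announce)

section \<open>The bisection protocol\<close>

text \<open>The inserted \<open>0\<close> encodes that a player has no element in \<open>I\<close>.\<close>

definition max_within :: "nat set \<Rightarrow> nat set \<Rightarrow> nat" where
  "max_within I X = Max (insert 0 (X \<inter> I))"

text \<open>The interval searched is \<open>{a<..a + L}\<close>. Counting the whole prefix up to the
  midpoint, not just the lower half, keeps the target rank \<open>r\<close> fixed. Both halves get
  the rounded-up length, so the lengths do not depend on the inputs.\<close>

primrec bisect :: "nat \<Rightarrow> nat list \<Rightarrow> nat \<Rightarrow> nat \<Rightarrow> nat \<Rightarrow> nat \<Rightarrow> (nat set, nat) protocol" where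
  "bisect b is r 0 a L =
     poll b (max_within {a<..a + L}) is (\<lambda>vs. Output (Max (set vs)))"
| "bisect b is r (Suc m) a L =
     poll b (\<lambda>X. card (X \<inter> {..a + (L + 1) div 2})) is (\<lambda>vs.
       if r \<le> sum_list vs then bisect b is r m a ((L + 1) div 2)
       else bisect b is r m (a + (L + 1) div 2) ((L + 1) div 2))"

definition median_search :: "nat \<Rightarrow> nat list \<Rightarrow> nat \<Rightarrow> nat \<Rightarrow> (nat set, nat) protocol" where
  "median_search b is m n = poll b card is (\<lambda>vs. bisect b is ((sum_list vs + 1) div 2) m 0 n)"

lemma speakers_bisect: "speakers (bisect b is r m a L) \<subseteq> set is"
  by (induction m arbitrary: a L) (simp_all del: One_nat_def add: speakers_poll)

lemma speakers_median_search: "speakers (median_search b is m n) \<subseteq> set is"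
  unfolding median_search_def by (intro speakers_poll speakers_bisect order_refl)

section \<open>Correctness and cost on fixed inputs\<close>

context
  fixes A :: "nat \<Rightarrow> nat set" and "is" :: "nat list" and n b :: nat
  assumes inputs: "\<And>i. i \<in> set is \<Longrightarrow> A i \<subseteq> {1..n}"
    and disj: "disjoint_family_on A (set is)"
    and dist: "distinct is"
    and bits: "n < 2 ^ b"
begin

private abbreviation S :: "nat set" where "S \<equiv> \<Union>i\<in>set is. A i"

lemma finite_input: "i \<in> set is \<Longrightarrow> finite (A i)"
  using inputs finite_subset by blast

lemma card_input_less: "i \<in> set is \<Longrightarrow> card (A i \<inter> X) < 2 ^ b"
  using card_mono[of "{1..n}" "A i \<inter> X"] inputs[of i] bits by fastforce

lemma max_within_input_less:
  assumes "i \<in> set is"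
  shows "max_within I (A i) < 2 ^ b"
  unfolding max_within_def using assms finite_input[of i] inputs[of i] bits by (subst Max_less_iff) fastforce+

text \<open>Disjointness of the inputs enters here: the announced counts add up to a count in the
  union.\<close>

lemma sum_card_inputs: "(\<Sum>i\<leftarrow>is. card (A i \<inter> X)) = card (S \<inter> X)"
proof -
  have "card (S \<inter> X) = card (\<Union>i\<in>set is. A i \<inter> X)"
    by (simp add: Int_UN_distrib2 flip: UN_simps)
  also have "\<dots> = (\<Sum>i\<in>set is. card (A i \<inter> X))"
    using disj finite_input by (intro card_UN_disjoint) (auto simp: disjoint_family_on_def)
  finally show ?thesis
    using dist by (simp add: sum_list_distinct_conv_sum_set)
qed

text \<open>Every announced value is \<open>0\<close> or an element of \<open>S \<inter> I\<close>,
  and the player holding the maximum announces it.\<close>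

lemma Max_max_within_inputs:
  assumes "S \<inter> I \<noteq> {}"
  shows "Max ((\<lambda>i. max_within I (A i)) ` set is) = Max (S \<inter> I)"
proof (rule Max_eqI)
  have fin: "finite (S \<inter> I)" using finite_input by auto
  show "y \<le> Max (S \<inter> I)" if y: "y \<in> (\<lambda>i. max_within I (A i)) ` set is" for y
  proof -
    obtain i where i: "i \<in> set is" "y = max_within I (A i)" using y by blast
    have "finite (insert 0 (A i \<inter> I))" using i finite_input by simp
    then have "y \<in> insert 0 (A i \<inter> I)"
      unfolding i(2) max_within_def by (rule Max_in) simp
    then show ?thesis using fin i by (auto intro: Max_ge)
  qed
  obtain i where i: "i \<in> set is" "Max (S \<inter> I) \<in> A i \<inter> I"
    using Max_in[OF fin assms] by auto
  have "max_within I (A i) = Max (S \<inter> I)"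
    unfolding max_within_def using i fin finite_input by (intro Max_eqI) (auto intro: Max_ge)
  then show "Max (S \<inter> I) \<in> (\<lambda>i. max_within I (A i)) ` set is"
    using i by force
qed simp

text \<open>There are \<open>m\<close> halving polls and one final poll, each of
  \<open>length is * b\<close> bits whichever branch is taken.\<close>

lemma length_transcript_bisect:
  "length (transcript (bisect b is r m a L) A) = Suc m * (length is * b)"
  by (induction m arbitrary: a L)
     (simp_all add: length_transcript_poll card_input_less max_within_input_less)

lemma length_transcript_median_search:
  "length (transcript (median_search b is m n) A) = (m + 2) * (length is * b)"
  using card_input_less[of _ UNIV]
  by (simp add: median_search_def length_transcript_poll length_transcript_bisect)

text \<open>The two rank inequalities are the loop invariant: the element of rank \<open>r\<close>
  lies in the current interval. The quantity \<open>L - 1\<close> is tracked because rounding up to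
  \<open>(L + 1) div 2\<close> still at least halves it.\<close>

lemma result_bisect:
  assumes "card (S \<inter> {..a}) < r" "r \<le> card (S \<inter> {..a + L})"
  shows "\<exists>a' L'. card (S \<inter> {..a'}) < r \<and> r \<le> card (S \<inter> {..a' + L'}) \<and>
    2 ^ m * (L' - 1) \<le> L - 1 \<and> result (bisect b is r m a L) A = Max (S \<inter> {a'<..a' + L'})"
  using assms
proof (induction m arbitrary: a L)
  case 0
  have "S \<inter> {a<..a + L} \<noteq> {}"
  proof
    assume "S \<inter> {a<..a + L} = {}"
    then have "S \<inter> {..a + L} \<subseteq> S \<inter> {..a}" by fastforce
    then have "card (S \<inter> {..a + L}) \<le> card (S \<inter> {..a})" by (intro card_mono) auto
    with 0 show False by simp
  qed
  from Max_max_within_inputs[OF this] 0 show ?case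
    by (intro exI[of _ a] exI[of _ L]) (simp add: result_poll max_within_input_less)
next
  case (Suc m)
  define h where "h = (L + 1) div 2"
  have eq: "result (bisect b is r (Suc m) a L) A =
      result (if r \<le> card (S \<inter> {..a + h}) then bisect b is r m a h else bisect b is r m (a + h) h) A"
    by (simp add: result_poll card_input_less sum_card_inputs h_def)
  \<comment> \<open>For odd \<open>L\<close> the upper half reaches one past \<open>a + L\<close>,
    which can only increase the count.\<close>
  have "card (S \<inter> {..a + L}) \<le> card (S \<inter> {..a + h + h})"
    by (intro card_mono) (auto simp: h_def)
  with Suc.prems have "r \<le> card (S \<inter> {..a + h + h})" by simp
  then obtain a' L' where *: "card (S \<inter> {..a'}) < r" "r \<le> card (S \<inter> {..a' + L'})"
    "2 ^ m * (L' - 1) \<le> h - 1" "result (bisect b is r (Suc m) a L) A = Max (S \<inter> {a'<..a' + L'})"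
    using Suc.IH[of a h] Suc.IH[of "a + h" h] Suc.prems eq
    by (cases "r \<le> card (S \<inter> {..a + h})") (auto simp: not_le)
  have "2 ^ Suc m * (L' - 1) \<le> L - 1"
    using *(3) by (simp add: h_def)
  with * show ?case by blast
qed

text \<open>Here \<open>e\<close> is the final interval length minus one. The result
  \<open>x\<close> is the largest element of \<open>S\<close> in that interval, so \<open>x\<close>
  has rank at least \<open>r\<close>, and its rank exceeds \<open>r\<close> by at most
  \<open>e\<close>.\<close>

lemma result_median_search:
  assumes "S \<noteq> {}"
  obtains x e where "x \<in> S" "result (median_search b is m n) A = x" "2 ^ m * e < n"
    "card S \<le> 2 * card {y \<in> S. y < x} + 2" "card S \<le> 2 * card {y \<in> S. x < y} + 2 * e + 1"
proof -
  define t where "t = card S"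
  define r where "r = (t + 1) div 2"
  have fin: "finite S" using finite_input by auto
  have "t > 0" unfolding t_def using fin assms by (simp add: card_gt_0_iff)
  \<comment> \<open>The invariant holds initially for \<open>a = 0\<close> and \<open>L = n\<close>,
    as all inputs lie in \<open>{1..n}\<close>.\<close>
  have "S \<inter> {..n} = S" "S \<inter> {..0} = {}" using inputs by fastforce+
  with \<open>t > 0\<close> have "card (S \<inter> {..0}) < r" "r \<le> card (S \<inter> {..0 + n})"
    by (auto simp: r_def simp flip: t_def)
  from result_bisect[OF this, of m] obtain a L where
    aL: "card (S \<inter> {..a}) < r" "r \<le> card (S \<inter> {..a + L})" "2 ^ m * (L - 1) \<le> n - 1"
    and res: "result (bisect b is r m 0 n) A = Max (S \<inter> {a<..a + L})"
    by auto
  define x where "x = Max (S \<inter> {a<..a + L})"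
  have "result (median_search b is m n) A = x"
    using card_input_less[of _ UNIV] sum_card_inputs[of UNIV] res
    by (simp add: median_search_def result_poll r_def t_def x_def)
  have split: "S \<inter> {..a + L} = (S \<inter> {..a}) \<union> (S \<inter> {a<..a + L})" by auto
  have "card (S \<inter> {..a + L}) \<le> card (S \<inter> {..a}) + card (S \<inter> {a<..a + L})"
    unfolding split by (rule card_Un_le)
  moreover have "card (S \<inter> {a<..a + L}) \<le> L"
    using card_mono[of "{a<..a + L}" "S \<inter> {a<..a + L}"] by simp
  ultimately have card_le: "card (S \<inter> {..a + L}) \<le> card (S \<inter> {..a}) + L"
    and "S \<inter> {a<..a + L} \<noteq> {}" using aL by auto
  then have x: "x \<in> S" "a < x" "x \<le> a + L"
    using Max_in[of "S \<inter> {a<..a + L}"] by (auto simp: x_def)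
  have x_max: "y \<le> x" if "y \<in> S" "y \<le> a + L" for y
  proof (cases "a < y")
    case True
    then show ?thesis unfolding x_def using that by (intro Max_ge) auto
  qed (use x in simp)
  have "y \<le> a + L \<longleftrightarrow> y < x \<or> y = x" if "y \<in> S" for y
    using x x_max[OF that] by linarith
  \<comment> \<open>Maximality of \<open>x\<close> turns the prefix count at \<open>a + L\<close>
    into the rank of \<open>x\<close>.\<close>
  then have "S \<inter> {..a + L} = insert x {y \<in> S. y < x}"
    using x(1) by blast
  then have "card (S \<inter> {..a + L}) = Suc (card {y \<in> S. y < x})"
    using fin by simp
  with aL have below: "t \<le> 2 * card {y \<in> S. y < x} + 2"
    by (auto simp: r_def)
  have "S = (S \<inter> {..a + L}) \<union> {y \<in> S. x < y}"
    using x x_max by fastforce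
  then have "t \<le> card (S \<inter> {..a + L}) + card {y \<in> S. x < y}"
    unfolding t_def by (metis card_Un_le)
  \<comment> \<open>The prefix up to \<open>a + L\<close> has at most \<open>r - 1 + L\<close>
    elements, and \<open>2 * (r - 1) \<le> t - 1\<close>; moreover \<open>L \<ge> 1\<close>.\<close>
  with card_le aL(1,2) have above: "t \<le> 2 * card {y \<in> S. x < y} + 2 * (L - 1) + 1"
    unfolding r_def by linarith
  have "n > 0" using assms inputs by fastforce
  then have "2 ^ m * (L - 1) < n" using aL(3) by linarith
  with that[of x "L - 1"] x(1) \<open>result _ A = x\<close> below above show thesis by (simp add: t_def)
qed

end

section \<open>Mediocrity of the result\<close>

lemma mediocre_median_search:
  assumes A: "A \<in> admissible n k c" and "n < 2 ^ b" "n > 0"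
    and "2 * p < q" "0 < c" "2 * real q / c \<le> 2 ^ m"
  defines "S \<equiv> \<Union>i\<in>{1..k}. A i"
  defines "j \<equiv> nat \<lfloor>real p / real q * real (card S)\<rfloor>"
  shows "mediocre j j S (result (median_search b [1..<Suc k] m n) A)"
proof -
  have set: "set [1..<Suc k] = {1..k}" by auto
  have t: "c * real n \<le> real (card S)" using A by (simp add: admissible_def S_def)
  then have "card S > 0" using assms by (smt (verit) mult_pos_pos of_nat_0_less_iff)
  then have "S \<noteq> {}" by auto
  then obtain x e where x: "x \<in> S" "result (median_search b [1..<Suc k] m n) A = x"
    and e: "2 ^ m * e < n"
    and below: "card S \<le> 2 * card {y \<in> S. y < x} + 2"
    and above: "card S \<le> 2 * card {y \<in> S. x < y} + 2 * e + 1"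
    using A \<open>n < 2 ^ b\<close> unfolding admissible_def S_def
    by (elim result_median_search[of "[1..<Suc k]" A n b m, unfolded set, rotated 4]) auto
  have q: "real q > 0" using assms by simp
  \<comment> \<open>The number of rounds is large enough for the rank error to satisfy
    \<open>2 * q * e < card S\<close>.\<close>
  have "2 * real q / c * real e \<le> 2 ^ m * real e" using assms by (intro mult_right_mono) auto
  also have "\<dots> < real n" using e by (metis of_nat_less_iff of_nat_mult of_nat_numeral of_nat_power)
  finally have "2 * real q * real e < c * real n" using \<open>c > 0\<close> by (simp add: field_simps)
  with t have e_less: "2 * q * e < card S"
    by (metis less_le_trans of_nat_less_iff of_nat_mult of_nat_numeral)
  have "real j \<le> real p / real q * real (card S)" unfolding j_def by simp
  then have "real (j * q) \<le> real (p * card S)" using q by (simp add: field_simps)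
  then have "j * q \<le> p * card S" by (simp only: of_nat_le_iff)
  \<comment> \<open>Integrality sharpens \<open>2 * p < q\<close> to
    \<open>2 * p + 1 \<le> q\<close>; the extra \<open>card S\<close> pays for the error term
    \<open>2 * q * e\<close>.\<close>
  moreover have "(2 * p + 1) * card S \<le> q * card S" using assms by (intro mult_right_mono) auto
  ultimately have j: "2 * (j * q) + card S \<le> q * card S" by (simp add: algebra_simps)
  have "q * (2 * j + 2 * e) = 2 * (j * q) + 2 * q * e" by (simp add: algebra_simps)
  also have "\<dots> < q * card S" using j e_less by linarith
  finally have "2 * j + 2 * e < card S" by simp
  \<comment> \<open>The lower count only gives
    \<open>2 * j \<le> 2 * card {y \<in> S. y < x} + 1\<close>; parity removes the
    \<open>1\<close>.\<close>
  with below above have "j \<le> card {y \<in> S. y < x}" "j \<le> card {y \<in> S. x < y}" by linarith+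
  then show ?thesis
    using x by (simp add: mediocre_def top_elements_def bottom_elements_def)
qed

text \<open>The empty class of inputs is split off because \<open>cSUP_least\<close> needs a
  nonempty set; there the supremum is \<open>0\<close>.\<close>

lemma comm_complexity_le:
  assumes "\<And>A. A \<in> \<A> \<Longrightarrow> length (transcript P A) \<le> N"
  shows "comm_complexity P \<A> \<le> N"
proof (cases "\<A> = {}")
  case False
  then show ?thesis unfolding comm_complexity_def using assms by (rule cSUP_least)
qed (simp add: comm_complexity_def)

section \<open>The communication bound\<close>

lemma ex_mediocre_protocol:
  fixes c :: real
  assumes "0 < c" "c \<le> 1" "2 * p < q" "n \<ge> 2"
  shows "\<exists>P. finds_mediocre n k c (real p / real q) P \<and>
    real (comm_complexity P (admissible n k c))
      \<le> 6 * (real_of_int \<lceil>log 2 (2 * real q / c)\<rceil> * real k * log 2 (real n))"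
proof -
  define l where "l = \<lceil>log 2 (2 * real q / c)\<rceil>"
  define m where "m = nat l"
  have arg: "2 * real q / c > 1" using assms by (simp add: field_simps)
  then have "l \<ge> 1" unfolding l_def by simp
  then have m: "real m = real_of_int l" "m \<ge> 1" by (auto simp: m_def)
  have "log 2 (2 * real q / c) \<le> real m" unfolding m l_def by linarith
  then have pow: "2 * real q / c \<le> 2 ^ m"
    using arg by (simp add: log_le_iff powr_realpow)
  \<comment> \<open>\<open>d\<close> is the integer part of \<open>log 2 n\<close>, so
    \<open>d + 1\<close> bits suffice for every number in \<open>{0..n}\<close>.\<close>
  obtain d where d: "2 ^ d \<le> n" "n < 2 ^ (d + 1)"
    using ex_power_ivl1[of 2 n] assms by auto
  define b where "b = d + 1"
  have "real d \<le> log 2 (real n)"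
    using d(1) assms by (intro le_log2_of_power) auto
  moreover have "1 \<le> log 2 (real n)" using assms by simp
  ultimately have b: "real b \<le> 2 * log 2 (real n)" by (simp add: b_def)
  let ?P = "median_search b [1..<Suc k] m n"
  have set: "set [1..<Suc k] = {1..k}" by auto
  have "finds_mediocre n k c (real p / real q) ?P"
    unfolding finds_mediocre_def Let_def
    using speakers_median_search[of b "[1..<Suc k]" m n] mediocre_median_search[of _ n k c b p q m]
      d(2) pow assms unfolding set by (auto simp: b_def)
  moreover have "comm_complexity ?P (admissible n k c) \<le> (m + 2) * (k * b)"
  proof (rule comm_complexity_le)
    fix A assume "A \<in> admissible n k c"
    then show "length (transcript ?P A) \<le> (m + 2) * (k * b)"
      using length_transcript_median_search[of "[1..<Suc k]" A n b m] d(2)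
      unfolding set by (auto simp: admissible_def b_def)
  qed
  then have "real (comm_complexity ?P (admissible n k c)) \<le> real (m + 2) * (real k * real b)"
    by (metis of_nat_le_iff of_nat_mult)
  \<comment> \<open>The constant \<open>6\<close> is \<open>3 * 2\<close>:
    \<open>m + 2 \<le> 3 * m\<close> since \<open>m \<ge> 1\<close>, and
    \<open>b \<le> 2 * log 2 n\<close> since \<open>n \<ge> 2\<close>.\<close>
  moreover have "\<dots> \<le> (3 * real m) * (real k * (2 * log 2 (real n)))"
    using m b by (intro mult_mono) auto
  ultimately show ?thesis
    unfolding m l_def by (intro exI[of _ ?P]) (simp add: algebra_simps)
qed

theorem theorem2:
  "\<exists>C::real. C > 0 \<and> (\<forall>(q::nat) (c::real). q > 0 \<and> 0 < c \<and> c \<le> 1 \<longrightarrow>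
     (\<exists>D::real. D > 0 \<and> (\<forall>(p::nat) (n::nat) (k::nat).
        p > 0 \<and> real p < real q / 2 \<and> n \<ge> 2 \<and> k \<ge> 1 \<longrightarrow>
        (\<exists>P. finds_mediocre n k c (real p / real q) P \<and>
           real (comm_complexity P (admissible n k c))
             \<le> C * (real_of_int \<lceil>log 2 (2 * real q / c)\<rceil> * real k * log 2 (real n)) \<and>
           real (comm_complexity P (admissible n k c))
             \<le> D * (real k * log 2 (real n))))))"
proof (rule exI[of _ 6], intro conjI allI impI)
  fix q :: nat and c :: real
  assume qc: "q > 0 \<and> 0 < c \<and> c \<le> 1"
  \<comment> \<open>This factor depends on \<open>q\<close> and \<open>c\<close> only, so
    \<open>D = 6 * ?l\<close> may be chosen before \<open>p\<close>, \<open>n\<close> and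
    \<open>k\<close>, while \<open>6\<close> is absolute.\<close>
  let ?l = "real_of_int \<lceil>log 2 (2 * real q / c)\<rceil>"
  have "2 * real q / c > 1" using qc by (simp add: field_simps)
  then have "?l > 0" by simp
  then have "6 * ?l > 0" by simp
  moreover have "\<exists>P. finds_mediocre n k c (real p / real q) P \<and>
      real (comm_complexity P (admissible n k c)) \<le> 6 * (?l * real k * log 2 (real n)) \<and>
      real (comm_complexity P (admissible n k c)) \<le> 6 * ?l * (real k * log 2 (real n))"
    if "p > 0 \<and> real p < real q / 2 \<and> n \<ge> 2 \<and> k \<ge> 1" for p n k :: nat
    using ex_mediocre_protocol[of c p q n k] qc that by (simp add: mult.assoc)
  ultimately show "\<exists>D::real. D > 0 \<and> (\<forall>(p::nat) (n::nat) (k::nat).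
        p > 0 \<and> real p < real q / 2 \<and> n \<ge> 2 \<and> k \<ge> 1 \<longrightarrow>
        (\<exists>P. finds_mediocre n k c (real p / real q) P \<and>
           real (comm_complexity P (admissible n k c)) \<le> 6 * (?l * real k * log 2 (real n)) \<and>
           real (comm_complexity P (admissible n k c)) \<le> D * (real k * log 2 (real n))))"
    by (intro exI[of _ "6 * ?l"]) blast
qed simp

end
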